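(* Let $r$ and $g$ be positive integers with $r\le 5$, and let $k=rg$. Let $R$ be a connected graph with pairwise distinct vertices $u_1,\dots,u_{rg}$ and an automorphism $\psi$ such that $\psi(u_i)=u_{i+1}$ for all $i$ (indices modulo $rg$). Let $W_0$ be a loopless graph, vertex-disjoint from $R$, containing disjoint sets $V_1=\{w_i:i\in[rg]\}$ of $rg$ distinct vertices and $V_2=\{x_i:i\in[r]\}$ of $r$ distinct vertices (indices of $w$ modulo $rg$, indices of $x$ modulo $r$; $V_1\cup V_2$ may be a proper subset of $V(W_0)$), and suppose $W_0$ has two automorphisms $\phi$ and $\rho$ such that: (1) $\phi(w_i)=w_{i+g}$ for all $i\in[rg]$ and $\phi(x_i)=x_{i+1}$ for all $i\in[r]$; (2) for some $c\in[rg]$, $\rho(w_{1+s})=w_{c-s}$ for all integers $0\le s\le rg-1$, and for some $c'\in[r]$, $\rho(x_{1+i})=x_{c'-i}$ for all integers $0\le i\le r-1$. Let $Y$ be an arbitrary graph, vertex-disjoint from $R$ and $W_0$, with pairwise distinct vertices $y_1,\dots,y_r$, and let $W=W_0(x_1,\dots,x_r)\sqcup Y(y_1,\dots,y_r)$. Then $R(u_1,\dots,u_{rg})\sqcup W(w_1,\dots,w_{rg})$ and $R(u_{rg},\dots,u_1)\sqcup W(w_1,\dots,w_{rg})$ are $T$-equivalent.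
   Context: Graphs may have loops and parallel edges; $[m]=\{1,\dots,m\}$. The Tutte polynomial of $G=(V,E)$ is $T_G(x,y)=\sum_{A\subseteq E}(x-1)^{r(E)-r(A)}(y-1)^{|A|-r(A)}$ with $r(A)=|V|-c(A)$, $c(A)$ the number of components of $(V,A)$; two graphs are $T$-equivalent if they have the same Tutte polynomial. For vertex-disjoint graphs $G,W$ with distinct vertices $a_1,\dots,a_k\in V(G)$ and distinct $b_1,\dots,b_k\in V(W)$, $G(a_1,\dots,a_k)\sqcup W(b_1,\dots,b_k)$ is obtained from $G$ and $W$ by identifying $a_i$ with $b_i$ into a single vertex for every $i$. *)

theory Defs
  imports "HOL-Computational_Algebra.Polynomial"
begin

text \<open>
  Undirected multigraphs. An edge \<open>e\<close> has the set \<open>ends G e\<close> of end vertices, which is a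
  singleton exactly if \<open>e\<close> is a loop.
\<close>

record ('v, 'e) mgraph =
  verts :: "'v set"
  edges :: "'e set"
  ends :: "'e \<Rightarrow> 'v set"

definition finite_mgraph :: "('v, 'e) mgraph \<Rightarrow> bool" where
  "finite_mgraph G \<longleftrightarrow> finite (verts G) \<and> finite (edges G) \<and>
     (\<forall>e\<in>edges G. ends G e \<subseteq> verts G \<and> card (ends G e) \<in> {1, 2})"

definition loopless :: "('v, 'e) mgraph \<Rightarrow> bool" where
  "loopless G \<longleftrightarrow> (\<forall>e\<in>edges G. card (ends G e) \<noteq> 1)"

definition adjacency :: "('v, 'e) mgraph \<Rightarrow> 'e set \<Rightarrow> ('v \<times> 'v) set" where
  "adjacency G A = {(a, b). \<exists>e\<in>A. ends G e = {a, b}}"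

definition connection :: "('v, 'e) mgraph \<Rightarrow> 'e set \<Rightarrow> ('v \<times> 'v) set" where
  "connection G A = (adjacency G A)\<^sup>* \<inter> verts G \<times> verts G"

definition num_components :: "('v, 'e) mgraph \<Rightarrow> 'e set \<Rightarrow> nat" where
  "num_components G A = card (verts G // connection G A)"

definition connected_mgraph :: "('v, 'e) mgraph \<Rightarrow> bool" where
  "connected_mgraph G \<longleftrightarrow> verts G \<noteq> {} \<and>
     (\<forall>a\<in>verts G. \<forall>b\<in>verts G. (a, b) \<in> connection G (edges G))"

definition edge_rank :: "('v, 'e) mgraph \<Rightarrow> 'e set \<Rightarrow> nat" where
  "edge_rank G A = card (verts G) - num_components G A"

text \<open>
  The ring of integer polynomials in \<open>x\<close> and \<open>y\<close> is represented as \<open>int poly poly\<close>, with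
  \<open>x\<close> the indeterminate of the inner and \<open>y\<close> that of the outer polynomial ring.
  No truncation occurs in the subtractions of natural numbers for finite graphs and \<open>A \<subseteq> E\<close>.
\<close>

definition tutte_poly :: "('v, 'e) mgraph \<Rightarrow> int poly poly" where
  "tutte_poly G =
     (let x = [:[:0, 1:]:]; y = [:0, 1:] in
      \<Sum>A\<in>Pow (edges G). (x - 1) ^ (edge_rank G (edges G) - edge_rank G A) *
                         (y - 1) ^ (card A - edge_rank G A))"

definition T_equivalent :: "('v, 'e) mgraph \<Rightarrow> ('w, 'f) mgraph \<Rightarrow> bool" where
  "T_equivalent G H \<longleftrightarrow> tutte_poly G = tutte_poly H"

text \<open>
  An automorphism is given by its action on the vertices; because of parallel edges the
  accompanying bijection on the edges is not determined by it.
\<close>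

definition automorphism :: "('v, 'e) mgraph \<Rightarrow> ('v \<Rightarrow> 'v) \<Rightarrow> bool" where
  "automorphism G f \<longleftrightarrow> bij_betw f (verts G) (verts G) \<and>
     (\<exists>h. bij_betw h (edges G) (edges G) \<and> (\<forall>e\<in>edges G. ends G (h e) = f ` ends G e))"

text \<open>
  \<open>glue G as W bs\<close> is $G(a_1,\dots,a_k) \sqcup W(b_1,\dots,b_k)$, for graphs \<open>G\<close> and \<open>W\<close> with
  disjoint vertex sets and distinct lists \<open>as\<close>, \<open>bs\<close> of equal length. The vertex obtained by
  identifying $a_i$ with $b_i$ is called $a_i$. The edge sets are made disjoint by the sum type.
\<close>

definition identify :: "'v list \<Rightarrow> 'v list \<Rightarrow> 'v \<Rightarrow> 'v" where
  "identify as bs v = (case map_of (zip bs as) v of Some a \<Rightarrow> a | None \<Rightarrow> v)"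

definition glue ::
  "('v, 'e) mgraph \<Rightarrow> 'v list \<Rightarrow> ('v, 'f) mgraph \<Rightarrow> 'v list \<Rightarrow> ('v, 'e + 'f) mgraph" where
  "glue G as W bs =
     \<lparr>verts = verts G \<union> identify as bs ` verts W,
      edges = edges G <+> edges W,
      ends = case_sum (ends G) (\<lambda>e. identify as bs ` ends W e)\<rparr>"

text \<open>
  A family \<open>u\<^sub>1, \<dots>, u\<^sub>n\<close> of distinct elements, with indices read modulo \<open>n\<close>, is a function on
  the integers of period \<open>n\<close>.
\<close>

definition cyclic_family :: "nat \<Rightarrow> (int \<Rightarrow> 'v) \<Rightarrow> bool" where
  "cyclic_family n u \<longleftrightarrow> (\<forall>i. u (i + int n) = u i) \<and> inj_on u {1..int n}"

end

theory Submission
  imports Defs "HOL-Library.FuncSet"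
begin

text \<open>
  For a fixed set of edges of \<open>Y\<close>, the number of components depends on \<open>Y\<close> only through the
  partition induced on \<open>y\<^sub>1, \<dots>, y\<^sub>r\<close>. For \<open>r \<le> 5\<close> every partition of
  \<open>\<int>/r\<close> is invariant under some reflection, and such a reflection of \<open>x\<^sub>1, \<dots>, x\<^sub>r\<close> extends
  to an automorphism \<open>\<phi>\<^sup>j \<circ> \<rho>\<close> of \<open>W\<^sub>0\<close> that reverses the cyclic order of the \<open>w\<^sub>i\<close>. After a
  rotation of \<open>R\<close> by a power of \<open>\<psi>\<close> it carries one glued graph to the other. Thus the
  subset expansions of the two Tutte polynomials agree separately for every set of edges of \<open>Y\<close>.
\<close>

section \<open>Classes of symmetric relations\<close>

text \<open>Allowing an arbitrary relation in place of an edge set means that an identification of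
  two vertices can be recorded as an additional pair, with no quotient of the vertex set.\<close>

definition comps :: "'a set \<Rightarrow> ('a \<times> 'a) set \<Rightarrow> nat" where
  "comps V S = card (V // (S\<^sup>* \<inter> V \<times> V))"

lemma num_components_eq_comps: "num_components G A = comps (verts G) (adjacency G A)"
  by (simp add: num_components_def connection_def comps_def)

lemma equiv_rtrancl_on:
  assumes "sym S"
  shows "equiv V (S\<^sup>* \<inter> V \<times> V)"
proof (rule equivI)
  show "sym (S\<^sup>* \<inter> V \<times> V)"
    using sym_rtrancl[OF assms] by (auto simp: sym_def)
  show "trans (S\<^sup>* \<inter> V \<times> V)"
    by (rule transI) (auto intro: rtrancl_trans)
qed (auto simp: refl_on_def)

lemma rtrancl_map:
  assumes "(a, b) \<in> S\<^sup>*" and "\<And>a b. (a, b) \<in> S \<Longrightarrow> (F a, F b) \<in> T\<^sup>*"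
  shows "(F a, F b) \<in> T\<^sup>*"
  using assms(1) by (induction rule: rtrancl_induct) (auto intro: rtrancl_trans assms(2))

text \<open>Maps that preserve connection and are mutually inverse up to connection induce a
  bijection of classes. Neither \<open>F\<close> nor \<open>F'\<close> has to be injective, so whole
  classes may be collapsed to single vertices.\<close>

lemma comps_eqI:
  assumes sym: "sym S" "sym T"
    and F: "F \<in> V \<rightarrow> U" and F': "F' \<in> U \<rightarrow> V"
    and ST: "\<And>a b. (a, b) \<in> S \<Longrightarrow> (F a, F b) \<in> T\<^sup>*"
    and TS: "\<And>a b. (a, b) \<in> T \<Longrightarrow> (F' a, F' b) \<in> S\<^sup>*"
    and F'F: "\<And>a. a \<in> V \<Longrightarrow> (F' (F a), a) \<in> S\<^sup>*"
    and FF': "\<And>a. a \<in> U \<Longrightarrow> (F (F' a), a) \<in> T\<^sup>*"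
  shows "comps V S = comps U T"
proof -
  let ?S = "S\<^sup>* \<inter> V \<times> V" and ?T = "T\<^sup>* \<inter> U \<times> U"
  \<comment> \<open>The image of a class lies in a single class of \<open>T\<close>; saturating it
    yields that class without choosing a representative.\<close>
  let ?h = "\<lambda>X. ?T `` (F ` X)"
  have eS: "equiv V ?S" and eT: "equiv U ?T"
    using sym by (auto intro: equiv_rtrancl_on)
  have symS: "(b, a) \<in> S\<^sup>*" if "(a, b) \<in> S\<^sup>*" for a b
    using sym_rtrancl[OF sym(1)] that by (auto simp: sym_def)
  have F_iff: "(F a, F b) \<in> ?T \<longleftrightarrow> (a, b) \<in> ?S" if "a \<in> V" "b \<in> V" for a b
  proof
    assume "(F a, F b) \<in> ?T"
    then have "(F' (F a), F' (F b)) \<in> S\<^sup>*"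
      by (intro rtrancl_map[where F = F' and S = T, OF _ TS]) simp_all
    then have "(a, b) \<in> S\<^sup>*"
      using F'F[OF that(1)] F'F[OF that(2)] symS by (meson rtrancl_trans)
    then show "(a, b) \<in> ?S" using that by blast
  next
    assume "(a, b) \<in> ?S"
    then have "(F a, F b) \<in> T\<^sup>*"
      by (intro rtrancl_map[where F = F and S = S, OF _ ST]) simp_all
    then show "(F a, F b) \<in> ?T" using that F by blast
  qed
  have h: "?h (?S `` {a}) = ?T `` {F a}" if "a \<in> V" for a
  proof -
    have "(F a, F b) \<in> ?T" if "b \<in> ?S `` {a}" for b
      using that F_iff \<open>a \<in> V\<close> by blast
    moreover have "a \<in> ?S `` {a}" using \<open>a \<in> V\<close> by blast
    ultimately show ?thesis
      using equiv_class_eq[OF eT] by blast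
  qed
  have "bij_betw ?h (V // ?S) (U // ?T)"
    unfolding bij_betw_def
  proof
    show "inj_on ?h (V // ?S)"
    proof (rule inj_onI)
      fix X Y assume "X \<in> V // ?S" "Y \<in> V // ?S" and eq: "?h X = ?h Y"
      then obtain a b where ab: "a \<in> V" "b \<in> V" "X = ?S `` {a}" "Y = ?S `` {b}"
        by (auto elim!: quotientE)
      then have "?T `` {F a} = ?T `` {F b}" using eq h by simp
      then have "(F a, F b) \<in> ?T"
        using eq_equiv_class[OF _ eT] F ab by blast
      then show "X = Y"
        using F_iff ab equiv_class_eq[OF eS] by blast
    qed
    show "?h ` (V // ?S) = U // ?T"
    proof
      show "?h ` (V // ?S) \<subseteq> U // ?T"
      proof
        fix Z assume "Z \<in> ?h ` (V // ?S)"
        then obtain a where "a \<in> V" "Z = ?h (?S `` {a})" by (auto elim!: quotientE)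
        then show "Z \<in> U // ?T" using h F by (auto intro!: quotientI)
      qed
      show "U // ?T \<subseteq> ?h ` (V // ?S)"
      proof
        fix Z assume "Z \<in> U // ?T"
        then obtain c where c: "c \<in> U" "Z = ?T `` {c}" by (auto elim!: quotientE)
        have "F' c \<in> V" using F' c by blast
        moreover have "(F (F' c), c) \<in> ?T" using FF' c F calculation by blast
        ultimately have "Z = ?h (?S `` {F' c})"
          using h[of "F' c"] c(2) equiv_class_eq[OF eT, of "F (F' c)" c] by metis
        then show "Z \<in> ?h ` (V // ?S)"
          using \<open>F' c \<in> V\<close> by (blast intro: quotientI)
      qed
    qed
  qed
  then show ?thesis by (simp add: comps_def bij_betw_same_card)
qed

text \<open>
  Replacing \<open>P\<close> by its image under \<open>f\<close> permutes the attaching points \<open>x i\<close>. The part \<open>Q\<close> notices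
  this only through the partition that it induces on the \<open>y i\<close>, so it need not be moved by a
  bijection: every class of \<open>Q\<close> that contains some \<open>y i\<close> is collapsed to \<open>y (d - i)\<close>.
\<close>

lemma comps_reflect:
  fixes x y :: "int \<Rightarrow> 'a" and d :: int
  defines "X \<equiv> range (\<lambda>i. (x i, y i))"
  assumes MN: "M \<inter> N = {}" and f: "bij_betw f M M"
    and P: "P \<subseteq> M \<times> M" "sym P" and Q: "Q \<subseteq> N \<times> N" "sym Q"
    and xy: "range x \<subseteq> M" "range y \<subseteq> N"
    and fx: "\<And>i. f (x i) = x (d - i)"
    and reflect: "\<And>i j. (y i, y j) \<in> Q\<^sup>* \<Longrightarrow> (y (d - i), y (d - j)) \<in> Q\<^sup>*"
  shows "comps (M \<union> N) (P \<union> Q \<union> X \<union> X\<inverse>) =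
         comps (M \<union> N) (map_prod f f ` P \<union> Q \<union> X \<union> X\<inverse>)"
proof -
  \<comment> \<open>If \<open>Q\<close> joins \<open>v\<close> to no \<open>y i\<close>, the value
    \<open>pick v\<close> is arbitrary, and \<open>F\<close> avoids it. The argument
    \<open>f\<close> of \<open>F\<close> is kept variable because the inverse permutation is treated
    by the same formula.\<close>
  define pick where "pick v = (SOME i. (v, y i) \<in> Q\<^sup>*)" for v
  define F where "F f v = (if v \<in> M then f v
      else if \<exists>i. (v, y i) \<in> Q\<^sup>* then y (d - pick v) else v)" for f v
  have symQ: "(b, a) \<in> Q\<^sup>*" if "(a, b) \<in> Q\<^sup>*" for a b
    using sym_rtrancl[OF Q(2)] that by (auto simp: sym_def)
  have pick: "(v, y (pick v)) \<in> Q\<^sup>*" if "(v, y i) \<in> Q\<^sup>*" for v i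
    unfolding pick_def using that by (rule someI)
  \<comment> \<open>By \<open>reflect\<close>, any other index met by the class of \<open>v\<close>
    would lead to the same class, so the choice made by \<open>pick\<close> is immaterial.\<close>
  have pick_y: "(y (d - i), y (d - pick v)) \<in> Q\<^sup>*" if "(v, y i) \<in> Q\<^sup>*" for v i
    using reflect pick[OF that] symQ[OF that] by (meson rtrancl_trans)
  have F_in: "F f \<in> M \<union> N \<rightarrow> M \<union> N" if "f ` M \<subseteq> M" for f
    using that xy by (auto simp: F_def image_subset_iff)
  \<comment> \<open>The local \<open>f\<close>, \<open>P1\<close> and \<open>P2\<close> allow a
    second use with the inverse permutation and the two relations exchanged.\<close>
  have step: "(F f a, F f b) \<in> (P2 \<union> Q \<union> X \<union> X\<inverse>)\<^sup>*"
    if ab: "(a, b) \<in> P1 \<union> Q \<union> X \<union> X\<inverse>" and "P1 \<subseteq> M \<times> M" "sym P2"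
      and P12: "\<And>a b. (a, b) \<in> P1 \<Longrightarrow> (f a, f b) \<in> P2"
      and fx: "\<And>i. f (x i) = x (d - i)" for f P1 P2 a b
  proof -
    let ?T = "P2 \<union> Q \<union> X \<union> X\<inverse>"
    have symT: "sym (?T\<^sup>*)"
      using \<open>sym P2\<close> Q(2) by (intro sym_rtrancl) (auto simp: sym_def)
    have Q_le: "Q\<^sup>* \<subseteq> ?T\<^sup>*" by (rule rtrancl_mono) auto
    \<comment> \<open>The image of the link at \<open>i\<close> follows the link at
      \<open>d - i\<close> and then a path of \<open>Q\<close>, since \<open>y i\<close> is sent to
      the reflection of the picked index of its class.\<close>
    have X_step: "(F f (x i), F f (y i)) \<in> ?T\<^sup>*" for i
    proof -
      have "y i \<in> N" "x i \<in> M" using xy by auto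
      then have "y i \<notin> M" "x i \<in> M" using MN by auto
      then have "F f (x i) = x (d - i)" "F f (y i) = y (d - pick (y i))"
        using fx by (auto simp: F_def)
      moreover have "(x (d - i), y (d - i)) \<in> ?T" by (auto simp: X_def)
      moreover have "(y (d - i), y (d - pick (y i))) \<in> ?T\<^sup>*"
        using pick_y[of "y i" i] Q_le by auto
      ultimately show ?thesis by (simp add: converse_rtrancl_into_rtrancl)
    qed
    from ab consider "(a, b) \<in> P1" | "(a, b) \<in> Q" | "(a, b) \<in> X" | "(b, a) \<in> X" by blast
    then show ?thesis
    proof cases
      case 1
      then show ?thesis using P12 \<open>P1 \<subseteq> M \<times> M\<close> by (auto simp: F_def)
    next
      case 2
      then have notM: "a \<notin> M" "b \<notin> M" using Q MN by auto
      have iff: "(a, y i) \<in> Q\<^sup>* \<longleftrightarrow> (b, y i) \<in> Q\<^sup>*" for i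
        using 2 symQ by (meson converse_rtrancl_into_rtrancl r_into_rtrancl rtrancl_trans)
      show ?thesis
      proof (cases "\<exists>i. (a, y i) \<in> Q\<^sup>*")
        case True
        then obtain i where "(a, y i) \<in> Q\<^sup>*" "(b, y i) \<in> Q\<^sup>*" using iff by blast
        then have "(y (d - pick a), y (d - pick b)) \<in> Q\<^sup>*"
          using pick_y symQ by (meson rtrancl_trans)
        then show ?thesis using True iff notM Q_le by (auto simp: F_def)
      next
        case False
        then show ?thesis using 2 iff notM by (auto simp: F_def)
      qed
    next
      case 3
      then show ?thesis using X_step by (auto simp: X_def)
    next
      case 4
      then have "(F f b, F f a) \<in> ?T\<^sup>*" using X_step by (auto simp: X_def)
      then show ?thesis using symT by (auto simp: sym_def)
    qed
  qed
  \<comment> \<open>On \<open>M\<close> the permutations cancel. Elsewhere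
    \<open>d - (d - i) = i\<close>, so the double reflection returns to the original class and
    \<open>Q\<close> alone provides the path.\<close>
  have inverse: "(F f' (F f a), a) \<in> (P' \<union> Q \<union> X \<union> X\<inverse>)\<^sup>*"
    if "a \<in> M \<union> N" "f ` M \<subseteq> M" and f'f: "\<And>a. a \<in> M \<Longrightarrow> f' (f a) = a" for f f' a P'
  proof -
    have "(F f' (F f a), a) \<in> Q\<^sup>*"
    proof (cases "a \<in> M")
      case True
      then show ?thesis using that by (auto simp: F_def)
    next
      case False
      show ?thesis
      proof (cases "\<exists>i. (a, y i) \<in> Q\<^sup>*")
        case True
        then have a: "(a, y (pick a)) \<in> Q\<^sup>*" using pick by blast
        let ?b = "y (d - pick a)"
        have "?b \<in> N" using xy by auto
        then have "?b \<notin> M" using MN by auto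
        then have "F f' (F f a) = y (d - pick ?b)" using True False by (auto simp: F_def)
        moreover have "(y (d - (d - pick a)), y (d - pick ?b)) \<in> Q\<^sup>*"
          by (rule pick_y) simp
        ultimately show ?thesis
          using a symQ by (metis diff_diff_eq2 add_diff_cancel_left' rtrancl_trans)
      next
        case no: False
        then have "F f a = a" using False by (auto simp: F_def)
        then show ?thesis using no False by (auto simp: F_def)
      qed
    qed
    moreover have "Q\<^sup>* \<subseteq> (P' \<union> Q \<union> X \<union> X\<inverse>)\<^sup>*" by (rule rtrancl_mono) auto
    ultimately show ?thesis by blast
  qed
  let ?f' = "inv_into M f"
  have inj: "inj_on f M" and im: "f ` M = M" using f by (auto simp: bij_betw_def)
  have im': "?f' ` M \<subseteq> M" using im by (auto intro: inv_into_into)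
  have f'f: "?f' (f a) = a" if "a \<in> M" for a using inj that by simp
  have ff': "f (?f' a) = a" if "a \<in> M" for a using im that by (simp add: f_inv_into_f)
  let ?P2 = "map_prod f f ` P"
  have P2: "?P2 \<subseteq> M \<times> M" using P im by blast
  have symP2: "sym ?P2" using P by (auto simp: sym_def)
  \<comment> \<open>The index map is an involution, hence the inverse permutation obeys the same
    reflection law with the same \<open>d\<close>.\<close>
  have f'x: "?f' (x i) = x (d - i)" for i
    using f'f[of "x (d - i)"] fx[of "d - i"] xy by auto
  have P21: "(?f' a, ?f' b) \<in> P" if "(a, b) \<in> ?P2" for a b
    using that P f'f by auto
  have P12: "(f a, f b) \<in> ?P2" if "(a, b) \<in> P" for a b
    using that by auto
  show ?thesis
  proof (rule comps_eqI)
    show "sym (P \<union> Q \<union> X \<union> X\<inverse>)" "sym (?P2 \<union> Q \<union> X \<union> X\<inverse>)"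
      using P symP2 Q by (auto simp: sym_def)
    show "F f \<in> M \<union> N \<rightarrow> M \<union> N" "F ?f' \<in> M \<union> N \<rightarrow> M \<union> N"
      using F_in im im' by auto
    show "(F f a, F f b) \<in> (?P2 \<union> Q \<union> X \<union> X\<inverse>)\<^sup>*" if "(a, b) \<in> P \<union> Q \<union> X \<union> X\<inverse>" for a b
      using step[OF that P(1) symP2] P12 fx by blast
    show "(F ?f' a, F ?f' b) \<in> (P \<union> Q \<union> X \<union> X\<inverse>)\<^sup>*" if "(a, b) \<in> ?P2 \<union> Q \<union> X \<union> X\<inverse>" for a b
      using step[OF that P2 P(2)] P21 f'x by blast
    show "(F ?f' (F f a), a) \<in> (P \<union> Q \<union> X \<union> X\<inverse>)\<^sup>*" if "a \<in> M \<union> N" for a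
      using inverse[where f' = ?f' and f = f, OF that _ f'f] im by auto
    show "(F f (F ?f' a), a) \<in> (?P2 \<union> Q \<union> X \<union> X\<inverse>)\<^sup>*" if "a \<in> M \<union> N" for a
      using inverse[where f = ?f' and f' = f, OF that im' ff'] by auto
  qed
qed

section \<open>Components of glued graphs\<close>

lemma sym_adjacency: "sym (adjacency G A)"
  by (auto simp: sym_def adjacency_def insert_commute)

lemma adjacency_subset:
  assumes "finite_mgraph G" "A \<subseteq> edges G"
  shows "adjacency G A \<subseteq> verts G \<times> verts G"
  using assms by (fastforce simp: adjacency_def finite_mgraph_def)

lemma identify_notin:
  assumes "v \<notin> set bs"
  shows "identify as bs v = v"
proof -
  have "map_of (zip bs as) v = None"
    using assms by (auto simp: map_of_eq_None_iff dest: set_zip_leftD)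
  then show ?thesis by (simp add: identify_def)
qed

lemma identify_link:
  assumes "v \<in> set bs" "length as = length bs"
  shows "(identify as bs v, v) \<in> set (zip as bs)"
proof -
  obtain a where a: "map_of (zip bs as) v = Some a"
    using assms by (metis map_of_zip_is_Some)
  then have "(v, a) \<in> set (zip bs as)" by (rule map_of_SomeD)
  then show ?thesis using a by (auto simp: identify_def in_set_zip)
qed

lemma identify_eq:
  assumes "(a, b) \<in> set (zip as bs)" "distinct bs" "length as = length bs"
  shows "identify as bs b = a"
proof -
  have "(b, a) \<in> set (zip bs as)" using assms(1) by (auto simp: in_set_zip)
  then have "map_of (zip bs as) b = Some a"
    using assms by (intro map_of_is_SomeI) auto
  then show ?thesis by (simp add: identify_def)
qed

lemma verts_glue:
  assumes "set as \<subseteq> verts G" "length as = length bs"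
  shows "verts (glue G as W bs) = verts G \<union> (verts W - set bs)"
proof -
  have "identify as bs v \<in> verts G" if "v \<in> set bs" for v
    using identify_link[OF that assms(2)] assms(1) by (auto dest: set_zip_leftD)
  moreover have "identify as bs ` verts W =
      identify as bs ` (verts W \<inter> set bs) \<union> identify as bs ` (verts W - set bs)" by blast
  moreover have "identify as bs ` (verts W - set bs) = (\<lambda>v. v) ` (verts W - set bs)"
    by (rule image_cong) (auto simp: identify_notin)
  ultimately show ?thesis
    by (auto simp: glue_def)
qed

text \<open>Gluing may turn an edge into a loop by merging its two ends, but it never leaves an edge
  without ends.\<close>

lemma finite_mgraph_glue:
  assumes G: "finite_mgraph G" and W: "finite_mgraph W"
  shows "finite_mgraph (glue G as W bs)"
proof -
  have "card (identify as bs ` S) \<in> {1, 2}" if "card S \<in> {1, 2}" for S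
  proof -
    have "finite S" "S \<noteq> {}" using that by (auto intro: card_ge_0_finite)
    then have "card (identify as bs ` S) \<noteq> 0" "card (identify as bs ` S) \<le> card S"
      by (auto simp: card_image_le)
    then show ?thesis using that by auto
  qed
  then show ?thesis
    using G W by (fastforce simp: finite_mgraph_def glue_def)
qed

text \<open>The contraction \<open>identify as bs\<close> and the inclusion back are inverse up to
  the links in \<open>L\<close>, so \<open>comps_eqI\<close> applies. \<open>Z\<close> and
  \<open>E\<close> carry along the rest of a larger graph, which makes nested gluings
  accessible.\<close>

lemma comps_glue:
  fixes G :: "('v, 'e) mgraph" and W :: "('v, 'f) mgraph" and as bs :: "'v list"
  defines "L \<equiv> set (zip as bs)"
  assumes W: "finite_mgraph W" and A: "A \<subseteq> edges G" "B \<subseteq> edges W" and G: "finite_mgraph G"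
    and disj: "(Z \<union> verts G) \<inter> verts W = {}"
    and as: "set as \<subseteq> verts G" and bs: "set bs \<subseteq> verts W" "distinct bs" "length as = length bs"
    and E: "E \<subseteq> (Z \<union> verts G) \<times> (Z \<union> verts G)" "sym E"
  shows "comps (Z \<union> verts (glue G as W bs)) (E \<union> adjacency (glue G as W bs) (A <+> B)) =
         comps (Z \<union> verts G \<union> verts W)
           (E \<union> adjacency G A \<union> adjacency W B \<union> L \<union> L\<inverse>)"
    (is "comps ?U ?T = comps ?V ?S")
proof (rule sym, rule comps_eqI)
  let ?I = "identify as bs"
  have fix_Z: "?I v = v" if "v \<in> Z \<union> verts G" for v
    using that disj bs by (intro identify_notin) auto
  have link: "(?I v, v) \<in> ?S\<^sup>*" for v
  proof (cases "v \<in> set bs")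
    case True
    then have "(?I v, v) \<in> ?S" using identify_link bs by (auto simp: L_def)
    then show ?thesis by blast
  qed (simp add: identify_notin)
  show symS: "sym ?S" "sym ?T"
    using E sym_adjacency by (auto simp: sym_def dest: sym_adjacency[THEN symD])
  then have link': "(v, ?I v) \<in> ?S\<^sup>*" for v
    using link sym_rtrancl by (metis symD)
  show "?I \<in> ?V \<rightarrow> ?U"
    using fix_Z by (auto simp: glue_def)
  show "(\<lambda>v. v) \<in> ?U \<rightarrow> ?V"
    using verts_glue[OF as bs(3)] by auto
  show "(?I a, a) \<in> ?S\<^sup>*" for a by (rule link)
  show "(?I a, a) \<in> ?T\<^sup>*" if "a \<in> ?U" for a
    using that verts_glue[OF as bs(3), of W] fix_Z identify_notin[of a bs as] by auto
  show "(?I a, ?I b) \<in> ?T\<^sup>*" if "(a, b) \<in> ?S" for a b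
  proof -
    have L: "?I b = a" "?I a = a" if "(a, b) \<in> L" for a b
      using that identify_eq[OF _ bs(2,3)] fix_Z as by (auto simp: L_def dest: set_zip_leftD)
    from that consider "(a, b) \<in> E" | "(a, b) \<in> adjacency G A" | "(a, b) \<in> adjacency W B"
      | "(a, b) \<in> L" | "(b, a) \<in> L" by blast
    then show ?thesis
    proof cases
      case 1
      then have "?I a = a" "?I b = b" using E by (auto intro!: fix_Z)
      then show ?thesis using 1 by auto
    next
      case 2
      then have "?I a = a" "?I b = b"
        using adjacency_subset[OF G A(1)] by (auto intro!: fix_Z)
      moreover have "(a, b) \<in> ?T" using 2 by (force simp: adjacency_def glue_def)
      ultimately show ?thesis by auto
    next
      case 3
      then obtain e where "e \<in> B" "ends W e = {a, b}" by (auto simp: adjacency_def)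
      then have "(?I a, ?I b) \<in> ?T"
        by (auto simp: adjacency_def glue_def intro!: bexI[of _ "Inr e"])
      then show ?thesis by auto
    next
      case 4
      then show ?thesis using L by auto
    next
      case 5
      then show ?thesis using L by auto
    qed
  qed
  show "(a, b) \<in> ?S\<^sup>*" if ab: "(a, b) \<in> ?T" for a b
  \<comment> \<open>Once \<open>a\<close> and \<open>b\<close> differ, so do their preimages in an
    edge of \<open>W\<close>; having at most two ends, that edge then has exactly these preimages as
    ends.\<close>
  proof (cases "(a, b) \<in> E \<or> a = b")
    case True
    then show ?thesis by auto
  next
    case False
    then obtain e where e: "e \<in> A <+> B" "ends (glue G as W bs) e = {a, b}"
      using ab by (auto simp: adjacency_def)
    show ?thesis
    proof (cases e)
      case (Inl e')
      then have "(a, b) \<in> adjacency G A" using e by (auto simp: adjacency_def glue_def)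
      then show ?thesis by auto
    next
      case (Inr e')
      then have e': "e' \<in> B" "?I ` ends W e' = {a, b}" using e by (auto simp: glue_def)
      then have "a \<in> ?I ` ends W e'" "b \<in> ?I ` ends W e'" by simp_all
      then obtain a' b' where a'b': "a' \<in> ends W e'" "b' \<in> ends W e'" "?I a' = a" "?I b' = b"
        by blast
      have "card (ends W e') \<in> {1, 2}" using e' A W by (auto simp: finite_mgraph_def)
      moreover have "a' \<noteq> b'" using a'b' False by auto
      ultimately have "ends W e' = {a', b'}"
        using a'b' by (auto simp: card_1_singleton_iff card_2_iff)
      then have "(a', b') \<in> ?S" using e' by (auto simp: adjacency_def)
      then show ?thesis
        using link[of a'] link'[of b'] a'b' by (metis rtrancl_trans r_into_rtrancl)
    qed
  qed
qed

text \<open>Both gluings are unfolded by \<open>comps_glue\<close>: the outer one with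
  \<open>Z\<close> and \<open>E\<close> empty, the inner one with \<open>R\<close> and the outer
  links as the part carried along. On the resulting disjoint union the three graphs can be moved
  independently.\<close>

lemma num_components_glue_glue:
  fixes R :: "('v, 'e) mgraph" and G :: "('v, 'f) mgraph" and Y :: "('v, 'h) mgraph"
  assumes fin: "finite_mgraph R" "finite_mgraph G" "finite_mgraph Y"
    and disj: "verts R \<inter> verts G = {}" "verts R \<inter> verts Y = {}" "verts G \<inter> verts Y = {}"
    and us: "set us \<subseteq> verts R" "length us = length ws"
    and ws: "set ws \<subseteq> verts G" "distinct ws"
    and xs: "set xs \<subseteq> verts G" "length xs = length ys"
    and ys: "set ys \<subseteq> verts Y" "distinct ys"
    and A: "A \<subseteq> edges R" "B \<subseteq> edges G" "C \<subseteq> edges Y"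
  shows "num_components (glue R us (glue G xs Y ys) ws) (A <+> (B <+> C)) =
    comps (verts R \<union> verts G \<union> verts Y)
      (adjacency R A \<union> adjacency G B \<union> set (zip us ws) \<union> (set (zip us ws))\<inverse> \<union>
       adjacency Y C \<union> set (zip xs ys) \<union> (set (zip xs ys))\<inverse>)"
proof -
  let ?W = "glue G xs Y ys" and ?L = "set (zip us ws)"
  let ?E = "adjacency R A \<union> ?L \<union> ?L\<inverse>"
  have vW: "verts ?W = verts G \<union> (verts Y - set ys)" using verts_glue xs by blast
  have "num_components (glue R us ?W ws) (A <+> (B <+> C)) =
      comps ({} \<union> verts (glue R us ?W ws)) ({} \<union> adjacency (glue R us ?W ws) (A <+> (B <+> C)))"
    by (simp add: num_components_eq_comps)
  also have "\<dots> = comps ({} \<union> verts R \<union> verts ?W)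
      ({} \<union> adjacency R A \<union> adjacency ?W (B <+> C) \<union> ?L \<union> ?L\<inverse>)"
    using A us ws fin disj vW
    by (intro comps_glue finite_mgraph_glue) (auto simp: glue_def sym_def)
  also have "\<dots> = comps (verts R \<union> verts ?W) (?E \<union> adjacency ?W (B <+> C))"
    by (simp add: Un_ac)
  also have "\<dots> = comps (verts R \<union> verts G \<union> verts Y)
      (?E \<union> adjacency G B \<union> adjacency Y C \<union> set (zip xs ys) \<union> (set (zip xs ys))\<inverse>)"
  proof (rule comps_glue)
    show "?E \<subseteq> (verts R \<union> verts G) \<times> (verts R \<union> verts G)"
      using adjacency_subset[OF fin(1) A(1)] us ws by (auto dest: set_zip_leftD set_zip_rightD)
    show "sym ?E" using sym_adjacency[of R A] by (auto simp: sym_def)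
  qed (use A fin disj xs ys in auto)
  finally show ?thesis by (simp add: Un_ac)
qed

section \<open>Automorphisms\<close>

lemma automorphism_comp:
  assumes "automorphism G f" "automorphism G f'"
  shows "automorphism G (f \<circ> f')"
proof -
  obtain h h' where h: "bij_betw h (edges G) (edges G)" "\<forall>e\<in>edges G. ends G (h e) = f ` ends G e"
    "bij_betw h' (edges G) (edges G)" "\<forall>e\<in>edges G. ends G (h' e) = f' ` ends G e"
    using assms by (auto simp: automorphism_def)
  have "\<forall>e\<in>edges G. ends G ((h \<circ> h') e) = (f \<circ> f') ` ends G e"
    using h bij_betwE[OF h(3)] by (auto simp: image_comp)
  then show ?thesis
    using assms bij_betw_trans[OF h(3,1)] by (auto simp: automorphism_def intro: bij_betw_trans)
qed

lemma automorphism_funpow: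
  assumes "automorphism G f"
  shows "automorphism G (f ^^ n)"
proof (induction n)
  case 0
  have "bij_betw id (edges G) (edges G)" "bij_betw id (verts G) (verts G)"
    "\<forall>e\<in>edges G. ends G (id e) = id ` ends G e" by auto
  then show ?case unfolding automorphism_def funpow_0 by (auto simp: id_def)
next
  case (Suc n)
  then show ?case unfolding funpow.simps by (rule automorphism_comp[OF assms])
qed

text \<open>As \<open>f\<close> is injective on the vertices, the ends of an edge can be recovered
  from their image. The lemma turns the action of an automorphism on edge sets into one on
  relations.\<close>

lemma adjacency_image:
  assumes G: "finite_mgraph G" and A: "A \<subseteq> edges G" and f: "inj_on f (verts G)"
    and h: "\<forall>e\<in>edges G. ends G (h e) = f ` ends G e"
  shows "adjacency G (h ` A) = map_prod f f ` adjacency G A"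
proof (intro set_eqI iffI)
  fix p assume "p \<in> adjacency G (h ` A)"
  then obtain a b e where p: "p = (a, b)" "e \<in> A" "f ` ends G e = {a, b}"
    using A h by (auto simp: adjacency_def)
  then have "a \<in> f ` ends G e" "b \<in> f ` ends G e" by simp_all
  then obtain a' b' where a'b': "a' \<in> ends G e" "b' \<in> ends G e" "f a' = a" "f b' = b"
    by blast
  have "ends G e \<subseteq> verts G" using p A G by (auto simp: finite_mgraph_def)
  then have "ends G e = {a', b'}"
    using p(3) a'b' inj_on_image_eq_iff[OF f, of "ends G e" "{a', b'}"] by auto
  then show "p \<in> map_prod f f ` adjacency G A"
    using p a'b' by (auto simp: adjacency_def intro!: image_eqI[of _ _ "(a', b')"])
next
  fix p assume "p \<in> map_prod f f ` adjacency G A"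
  then obtain a b e where "p = (f a, f b)" "e \<in> A" "ends G e = {a, b}"
    by (auto simp: adjacency_def)
  moreover from this have "ends G (h e) = {f a, f b}" using A h by auto
  ultimately show "p \<in> adjacency G (h ` A)" by (auto simp: adjacency_def)
qed

section \<open>Tutte polynomials\<close>

text \<open>The bijection of the edges may depend on an invariant \<open>p\<close> of the edge set.\<close>

lemma T_equivalent_fibrewise:
  assumes fin: "finite E" and E: "edges G = E" "edges H = E"
    and V: "verts G = verts H"
    and bij: "\<And>B. \<exists>h. bij_betw h E E \<and> (\<forall>A\<subseteq>E. p A = B \<longrightarrow>
        p (h ` A) = B \<and> num_components G A = num_components H (h ` A))"
  shows "T_equivalent G H"
proof -
  obtain h where h: "\<And>B. bij_betw (h B) E E"
    and p: "\<And>A. A \<subseteq> E \<Longrightarrow> p (h (p A) ` A) = p A"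
    and nc: "\<And>A. A \<subseteq> E \<Longrightarrow> num_components G A = num_components H (h (p A) ` A)"
    using bij by metis
  \<comment> \<open>Each fibre of \<open>p\<close> is permuted by its own bijection. Since
    \<open>k\<close> preserves \<open>p\<close>, the value \<open>p (k A)\<close> reveals which
    bijection was applied, and \<open>k\<close> is injective on all subsets.\<close>
  define k where "k A = h (p A) ` A" for A
  have inj: "inj_on (h B) E" and im: "h B ` E = E" for B
    using h by (auto simp: bij_betw_def)
  have "inj_on k (Pow E)"
  proof (rule inj_onI)
    fix A A' assume A: "A \<in> Pow E" "A' \<in> Pow E" and eq: "k A = k A'"
    then have "p A = p A'" using p by (metis PowD k_def)
    then show "A = A'"
      using eq A inj_on_image_eq_iff[OF inj] by (auto simp: k_def)
  qed
  moreover have "k ` Pow E \<subseteq> Pow E" using im by (auto simp: k_def)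
  ultimately have "bij_betw k (Pow E) (Pow E)"
    using fin by (simp add: bij_betw_def endo_inj_surj)
  moreover have card: "card (k A) = card A" if "A \<subseteq> E" for A
    using inj that by (auto simp: k_def intro: card_image inj_on_subset)
  moreover have rank: "edge_rank G A = edge_rank H (k A)" if "A \<subseteq> E" for A
    using nc[OF that] V by (simp add: edge_rank_def k_def)
  \<comment> \<open>With this, \<open>rank\<close> also covers the full edge set, whose rank enters
    every exponent of \<open>x - 1\<close>.\<close>
  moreover have "k E = E" using im by (simp add: k_def)
  ultimately have "tutte_poly G = tutte_poly H"
    unfolding tutte_poly_def Let_def E
    by (subst sum.reindex_bij_betw[of k "Pow E" "Pow E", symmetric])
      (auto intro!: sum.cong simp: rank)
  then show ?thesis by (simp add: T_equivalent_def)
qed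

section \<open>Cyclic index sets\<close>

lemma periodic_mult:
  fixes u :: "int \<Rightarrow> 'a"
  assumes "\<And>i. u (i + n) = u i"
  shows "u (i + n * m) = u i"
proof -
  have nat: "u (i + n * int m) = u i" for i m
  proof (induction m)
    case (Suc m)
    then show ?case using assms[of "i + n * int m"] by (simp add: algebra_simps)
  qed simp
  show ?thesis
  proof (cases "0 \<le> m")
    case True
    then show ?thesis using nat[of i "nat m"] by simp
  next
    case False
    \<comment> \<open>For negative \<open>m\<close> the natural case is read backwards, starting
      from the shifted index.\<close>
    then show ?thesis using nat[of "i + n * m" "nat (- m)"] by simp
  qed
qed

lemma periodic_cong:
  fixes u :: "int \<Rightarrow> 'a"
  assumes "\<And>i. u (i + n) = u i" and "i mod n = j mod n"
  shows "u i = u j"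
proof -
  obtain m where "i = j + n * m" using assms(2) by (metis mod_eqE)
  then show ?thesis using periodic_mult[of u n, OF assms(1)] by simp
qed

lemma periodic_reduce:
  fixes i :: int
  assumes "0 < n"
  obtains j where "j \<in> {1..n}" "j mod n = i mod n"
proof
  \<comment> \<open>Shifting by 1 before and after the reduction gives representatives in
    \<open>1..n\<close> instead of \<open>0..n-1\<close>.\<close>
  show "(i - 1) mod n + 1 \<in> {1..n}" using assms by (simp add: add1_zle_eq)
  show "((i - 1) mod n + 1) mod n = i mod n" by (simp add: mod_add_left_eq)
qed

lemma periodic_image:
  fixes u :: "int \<Rightarrow> 'a"
  assumes "\<And>i. u (i + n) = u i" "0 < n"
  shows "u ` {1..n} = range u"
proof
  show "range u \<subseteq> u ` {1..n}"
  proof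
    fix a assume "a \<in> range u"
    then obtain i where "a = u i" by blast
    obtain j where j: "j \<in> {1..n}" "j mod n = i mod n" using periodic_reduce[OF assms(2)] .
    then have "u j = u i" by (intro periodic_cong[of u n, OF assms(1)])
    then show "a \<in> u ` {1..n}" using j(1) \<open>a = u i\<close> by (metis imageI)
  qed
qed auto

lemma periodic_all:
  fixes P :: "int \<Rightarrow> bool"
  assumes "\<And>i. P (i + n) = P i" "0 < n" "\<forall>i\<in>{1..n}. P i"
  shows "P i"
  proof -
  obtain j where "j \<in> {1..n}" "j mod n = i mod n" using periodic_reduce[OF assms(2)] .
  moreover from this have "P j = P i" by (intro periodic_cong[of P n, OF assms(1)])
  ultimately show ?thesis using assms(3) by simp
qed

text \<open>Here \<open>e\<close> is a partition of the integers modulo \<open>r\<close>, and for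
  such small \<open>r\<close> a case check finds a reflection preserving it. The bound is sharp: for
  \<open>r = 6\<close> the block {0, 1, 3} with singletons has cyclic gaps 1, 2, 3, an order that no
  reflection preserves.\<close>

lemma invariant_reflection:
  fixes e :: "int \<Rightarrow> int \<Rightarrow> bool"
  assumes r: "0 < r" "r \<le> 5"
    and per: "\<And>i j. e (i + r) j = e i j" "\<And>i j. e i (j + r) = e i j"
    and refl: "\<And>i. e i i" and sym: "\<And>i j. e i j \<Longrightarrow> e j i"
    and trans: "\<And>i j k. e i j \<Longrightarrow> e j k \<Longrightarrow> e i k"
  shows "\<exists>d. \<forall>i j. e i j \<longrightarrow> e (d - i) (d - j)"
proof -
  have e_mod: "e i j \<longleftrightarrow> e (i mod r) (j mod r)" for i j
  proof -
    have "e i j = e (i mod r) j"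
      by (rule periodic_cong[of "\<lambda>i. e i j" r]) (auto simp: per)
    also have "\<dots> = e (i mod r) (j mod r)"
      by (rule periodic_cong[of "e (i mod r)" r]) (auto simp: per)
    finally show ?thesis .
  qed
  have "\<exists>d. \<forall>i\<in>{0..<r}. \<forall>j\<in>{0..<r}. e i j \<longrightarrow> e ((d - i) mod r) ((d - j) mod r)"
  proof -
    have S: "e 1 0 = e 0 1" "e 2 0 = e 0 2" "e 3 0 = e 0 3" "e 4 0 = e 0 4" "e 2 1 = e 1 2"
      "e 3 1 = e 1 3" "e 4 1 = e 1 4" "e 3 2 = e 2 3" "e 4 2 = e 2 4" "e 4 3 = e 3 4"
      using sym by blast+
    \<comment> \<open>All three forms of transitivity for an increasing triple, with
      \<open>S\<close> orienting every pair upwards, reduce the existence of a reflection to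
      propositional logic in the atoms \<open>e i j\<close> with \<open>i < j\<close>.\<close>
    have T: "(e i j \<and> e j k \<longrightarrow> e i k) \<and> (e i j \<and> e i k \<longrightarrow> e j k) \<and>
        (e i k \<and> e j k \<longrightarrow> e i j)" for i j k
      using sym trans by blast
    have I: "{0..<1} = {0::int}" "{0..<2} = {0::int,1}" "{0..<3} = {0::int,1,2}"
      "{0..<4} = {0::int,1,2,3}" "{0..<5} = {0::int,1,2,3,4}" by auto
    note T5 = T[of 0 1 2] T[of 0 1 3] T[of 0 1 4] T[of 0 2 3] T[of 0 2 4] T[of 0 3 4]
      T[of 1 2 3] T[of 1 2 4] T[of 1 3 4] T[of 2 3 4]
    from r consider "r = 1" | "r = 2" | "r = 3" | "r = 4" | "r = 5" by linarith
    then show ?thesis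
    proof cases
      case 3
      \<comment> \<open>Alternative (d) equates the pairs that \<open>i\<close> to
        \<open>d - i\<close> interchanges, that is, it says that this reflection preserves
        \<open>e\<close>. The cases \<open>r = 4\<close> and \<open>r = 5\<close> follow the same
        scheme.\<close>
      consider (0) "e 0 1 = e 0 2" |
        (1) "e 0 2 = e 1 2" |
        (2) "e 0 1 = e 1 2"
        using T5 by argo
      then show ?thesis
      proof cases
        case 0
        then show ?thesis by (intro exI[of _ 0]) (simp add: \<open>r = 3\<close> I refl S)
      next
        case 1
        then show ?thesis by (intro exI[of _ 1]) (simp add: \<open>r = 3\<close> I refl S)
      next
        case 2
        then show ?thesis by (intro exI[of _ 2]) (simp add: \<open>r = 3\<close> I refl S)
      qed
    next
      case 4
      consider (0) "e 0 1 = e 0 3 \<and> e 1 2 = e 2 3" |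
        (1) "e 0 2 = e 1 3 \<and> e 0 3 = e 1 2" |
        (2) "e 0 1 = e 1 2 \<and> e 0 3 = e 2 3" |
        (3) "e 0 1 = e 2 3 \<and> e 0 2 = e 1 3"
        using T5 by argo
      then show ?thesis
      proof cases
        case 0
        then show ?thesis by (intro exI[of _ 0]) (simp add: \<open>r = 4\<close> I refl S)
      next
        case 1
        then show ?thesis by (intro exI[of _ 1]) (simp add: \<open>r = 4\<close> I refl S)
      next
        case 2
        then show ?thesis by (intro exI[of _ 2]) (simp add: \<open>r = 4\<close> I refl S)
      next
        case 3
        then show ?thesis by (intro exI[of _ 3]) (simp add: \<open>r = 4\<close> I refl S)
      qed
    next
      case 5
      consider (0) "e 0 1 = e 0 4 \<and> e 0 2 = e 0 3 \<and> e 1 2 = e 3 4 \<and> e 1 3 = e 2 4" |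
        (1) "e 0 2 = e 1 4 \<and> e 0 3 = e 1 3 \<and> e 0 4 = e 1 2 \<and> e 2 3 = e 3 4" |
        (2) "e 0 1 = e 1 2 \<and> e 0 3 = e 2 4 \<and> e 0 4 = e 2 3 \<and> e 1 3 = e 1 4" |
        (3) "e 0 1 = e 2 3 \<and> e 0 2 = e 1 3 \<and> e 0 4 = e 3 4 \<and> e 1 4 = e 2 4" |
        (4) "e 0 1 = e 3 4 \<and> e 0 2 = e 2 4 \<and> e 0 3 = e 1 4 \<and> e 1 2 = e 2 3"
        using T5 by argo
      then show ?thesis
      proof cases
        case 0
        then show ?thesis by (intro exI[of _ 0]) (simp add: \<open>r = 5\<close> I refl S)
      next
        case 1
        then show ?thesis by (intro exI[of _ 1]) (simp add: \<open>r = 5\<close> I refl S)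
      next
        case 2
        then show ?thesis by (intro exI[of _ 2]) (simp add: \<open>r = 5\<close> I refl S)
      next
        case 3
        then show ?thesis by (intro exI[of _ 3]) (simp add: \<open>r = 5\<close> I refl S)
      next
        case 4
        then show ?thesis by (intro exI[of _ 4]) (simp add: \<open>r = 5\<close> I refl S)
      qed
    \<comment> \<open>For \<open>r = 1\<close> and \<open>r = 2\<close> negation is the identity
      modulo \<open>r\<close>, so \<open>d = 0\<close> serves.\<close>
    qed (auto intro!: exI[of _ 0] simp: I refl S)
  qed
  then obtain d where
    d: "\<And>i j. i \<in> {0..<r} \<Longrightarrow> j \<in> {0..<r} \<Longrightarrow> e i j \<Longrightarrow> e ((d - i) mod r) ((d - j) mod r)"
    by blast
  have "e (d - i) (d - j)" if "e i j" for i j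
  proof -
    have "e ((d - i mod r) mod r) ((d - j mod r) mod r)"
      using that e_mod[of i j] r by (intro d) auto
    then show ?thesis using e_mod[of "d - i" "d - j"] by (simp add: mod_diff_right_eq)
  qed
  then show ?thesis by blast
qed

section \<open>Bijections of disjoint unions and lists of glued pairs\<close>

lemma map_sum_image_Plus: "map_sum f h ` (A <+> B) = f ` A <+> h ` B"
  by (auto simp: Plus_def image_Un image_image)

lemma bij_betw_map_sum:
  assumes "bij_betw f A A'" "bij_betw h B B'"
  shows "bij_betw (map_sum f h) (A <+> B) (A' <+> B')"
proof -
  have "inj_on (map_sum f h) (A <+> B)"
    using assms by (intro inj_onI) (elim PlusE; auto simp: bij_betw_def dest: inj_onD)
  then show ?thesis using assms by (simp add: bij_betw_def map_sum_image_Plus)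
qed

lemma set_zip_map: "set (zip (map f l) (map h l)) = (\<lambda>i. (f i, h i)) ` set l"
  by (induction l) auto

lemma rev_upto: "rev [1..int k] = map (\<lambda>i. int k + 1 - i) [1..int k]"
  by (rule nth_equalityI) (auto simp: rev_nth)

section \<open>Reversing the attachment of \<open>R\<close> by a reflection of
  \<open>W0\<close>\<close>

theorem theorem4p2:
  fixes r g k :: nat
    and R :: "('v, 'e) mgraph" and W0 :: "('v, 'f) mgraph" and Y :: "('v, 'h) mgraph"
    and W :: "('v, 'f + 'h) mgraph"
    and u w x y :: "int \<Rightarrow> 'v"
    and \<psi> \<phi> \<rho> :: "'v \<Rightarrow> 'v"
  assumes "0 < r" and "r \<le> 5" and "0 < g" and "k = r * g"
    and "finite_mgraph R" and "connected_mgraph R"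
    and "cyclic_family k u" and "u ` {1..int k} \<subseteq> verts R"
    and "automorphism R \<psi>" and "\<forall>i\<in>{1..int k}. \<psi> (u i) = u (i + 1)"
    and "finite_mgraph W0" and "loopless W0" and "verts R \<inter> verts W0 = {}"
    and "cyclic_family k w" and "w ` {1..int k} \<subseteq> verts W0"
    and "cyclic_family r x" and "x ` {1..int r} \<subseteq> verts W0"
    and "w ` {1..int k} \<inter> x ` {1..int r} = {}"
    and "automorphism W0 \<phi>" and "automorphism W0 \<rho>"
    and "\<forall>i\<in>{1..int k}. \<phi> (w i) = w (i + int g)"
    and "\<forall>i\<in>{1..int r}. \<phi> (x i) = x (i + 1)"
    and "\<exists>c\<in>{1..int k}. \<forall>s\<in>{0..int k - 1}. \<rho> (w (1 + s)) = w (c - s)"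
    and "\<exists>c'\<in>{1..int r}. \<forall>i\<in>{0..int r - 1}. \<rho> (x (1 + i)) = x (c' - i)"
    and "finite_mgraph Y" and "verts R \<inter> verts Y = {}" and "verts W0 \<inter> verts Y = {}"
    and "inj_on y {1..int r}" and "y ` {1..int r} \<subseteq> verts Y"
    and "W = glue W0 (map x [1..int r]) Y (map y [1..int r])"
  shows "T_equivalent (glue R (map u [1..int k]) W (map w [1..int k]))
                      (glue R (rev (map u [1..int k])) W (map w [1..int k]))"
proof -
  have r: "0 < int r" "int r \<le> 5" and k: "0 < int k" using assms by auto
  have u_per: "u (i + int k) = u i" and w_per: "w (i + int k) = w i"
    and x_per: "x (i + int r) = x i" for i
    using assms(7,14,16) by (auto simp: cyclic_family_def)
  have u_in: "range u \<subseteq> verts R" and w_in: "range w \<subseteq> verts W0" and x_in: "range x \<subseteq> verts W0"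
    using assms(8,15,17) periodic_image[of u, OF u_per k] periodic_image[of w, OF w_per k]
      periodic_image[of x, OF x_per r(1)] by auto
  \<comment> \<open>The laws of the automorphisms are given on one period only; periodicity extends
    them to all integers, so that indices can be computed freely.\<close>
  have \<psi>: "\<psi> (u i) = u (i + 1)" for i
    by (rule periodic_all[OF _ k assms(10)]) (metis u_per add.assoc add.commute)
  have \<phi>w: "\<phi> (w i) = w (i + int g)" for i
    by (rule periodic_all[OF _ k assms(21)]) (metis w_per add.assoc add.commute)
  have \<phi>x: "\<phi> (x i) = x (i + 1)" for i
    by (rule periodic_all[OF _ r(1) assms(22)]) (metis x_per add.assoc add.commute)
  obtain c where c: "\<And>s. s \<in> {0..int k - 1} \<Longrightarrow> \<rho> (w (1 + s)) = w (c - s)"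
    using assms(23) by blast
  obtain c' where c': "\<And>s. s \<in> {0..int r - 1} \<Longrightarrow> \<rho> (x (1 + s)) = x (c' - s)"
    using assms(24) by blast
  \<comment> \<open>Putting \<open>i = 1 + s\<close> turns \<open>c - s\<close> into
    \<open>c + 1 - i\<close>; the same shift occurs for \<open>x\<close>.\<close>
  have \<rho>w: "\<rho> (w i) = w (c + 1 - i)" for i
  proof (rule periodic_all[of "\<lambda>i. \<rho> (w i) = w (c + 1 - i)", OF _ k])
    show "(\<rho> (w (i + int k)) = w (c + 1 - (i + int k))) = (\<rho> (w i) = w (c + 1 - i))" for i
      using w_per[of i] w_per[of "c + 1 - (i + int k)"] by (simp add: algebra_simps)
    show "\<forall>i\<in>{1..int k}. \<rho> (w i) = w (c + 1 - i)"
      using c[of "_ - 1"] by (auto simp: algebra_simps)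
  qed
  have \<rho>x: "\<rho> (x i) = x (c' + 1 - i)" for i
  proof (rule periodic_all[of "\<lambda>i. \<rho> (x i) = x (c' + 1 - i)", OF _ r(1)])
    show "(\<rho> (x (i + int r)) = x (c' + 1 - (i + int r))) = (\<rho> (x i) = x (c' + 1 - i))" for i
      using x_per[of i] x_per[of "c' + 1 - (i + int r)"] by (simp add: algebra_simps)
    show "\<forall>i\<in>{1..int r}. \<rho> (x i) = x (c' + 1 - i)"
      using c'[of "_ - 1"] by (auto simp: algebra_simps)
  qed
  \<comment> \<open>\<open>y\<close> is constrained on \<open>1..r\<close> only; \<open>z\<close> is
    its periodic extension.\<close>
  define z where "z i = y ((i - 1) mod int r + 1)" for i
  have z_per: "z (i + int r) = z i" for i
    by (simp add: z_def add.commute[of i] add_diff_eq[symmetric])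
  have z_y: "z i = y i" if "i \<in> {1..int r}" for i
    using that by (simp add: z_def)
  have z_in: "range z \<subseteq> verts Y"
  proof -
    have "z ` {1..int r} = y ` {1..int r}" using z_y by (rule image_cong[OF refl])
    then show ?thesis using assms(29) periodic_image[of z, OF z_per r(1)] by simp
  qed

  define L1 where "L1 = range (\<lambda>i. (u i, w i))"
  \<comment> \<open>Reversal glues \<open>w i\<close> to \<open>u (k + 1 - i)\<close>, which by
    periodicity is \<open>u (1 - i)\<close>.\<close>
  define L2 where "L2 = range (\<lambda>i. (u (1 - i), w i))"
  define X where "X = range (\<lambda>i. (x i, z i))"
  have zip1: "set (zip (map u [1..int k]) (map w [1..int k])) = L1"
    unfolding L1_def set_zip_map set_upto by (rule periodic_image[OF _ k]) (simp add: u_per w_per)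
  have zip2: "set (zip (rev (map u [1..int k])) (map w [1..int k])) = L2"
  proof -
    have "u (1 - i) = u (int k + 1 - i)" for i using u_per[of "1 - i"] by (simp add: algebra_simps)
    then have "rev (map u [1..int k]) = map (\<lambda>i. u (1 - i)) [1..int k]"
      by (simp add: rev_map rev_upto)
    moreover have "u (1 - (i + int k)) = u (1 - i)" for i
      using u_per[of "1 - (i + int k)"] by simp
    ultimately show ?thesis
      unfolding L2_def by (simp only: set_zip_map set_upto) (rule periodic_image[OF _ k], simp add: w_per)
  qed
  have zip3: "set (zip (map x [1..int r]) (map y [1..int r])) = X"
  proof -
    have "map y [1..int r] = map z [1..int r]" using z_y by auto
    then show ?thesis unfolding X_def
      by (simp only: set_zip_map set_upto) (rule periodic_image[OF _ r(1)], simp add: x_per z_per)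
  qed

  let ?V = "verts R \<union> verts W0 \<union> verts Y"
  let ?S = "\<lambda>A B C L. adjacency R A \<union> adjacency W0 B \<union> L \<union> L\<inverse> \<union> adjacency Y C \<union> X \<union> X\<inverse>"
  \<comment> \<open>The edge bijections depend on \<open>C\<close> but must serve all
    \<open>A\<close> and \<open>B\<close> at once, hence the order of the quantifiers.\<close>
  have key: "\<exists>hR h0. bij_betw hR (edges R) (edges R) \<and> bij_betw h0 (edges W0) (edges W0) \<and>
      (\<forall>A\<subseteq>edges R. \<forall>B\<subseteq>edges W0. comps ?V (?S A B C L1) = comps ?V (?S (hR ` A) (h0 ` B) C L2))"
    if C: "C \<subseteq> edges Y" for C
  proof -
    let ?Q = "adjacency Y C"
    obtain d where d: "\<And>i j. (z i, z j) \<in> ?Q\<^sup>* \<Longrightarrow> (z (d - i), z (d - j)) \<in> ?Q\<^sup>*"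
    proof -
      have "\<exists>d. \<forall>i j. (z i, z j) \<in> ?Q\<^sup>* \<longrightarrow> (z (d - i), z (d - j)) \<in> ?Q\<^sup>*"
        by (rule invariant_reflection[OF r])
          (auto simp: z_per intro: rtrancl_trans sym_rtrancl[OF sym_adjacency, THEN symD])
      then show ?thesis using that by blast
    qed
    \<comment> \<open>\<open>\<phi> ^^ j \<circ> \<rho>\<close> sends \<open>x i\<close> to
      \<open>x (c' + 1 - i + j)\<close>, which has to be \<open>x (d - i)\<close>. It also sends
      \<open>w i\<close> to \<open>w (s - i)\<close> with \<open>s = c + 1 + j * g\<close>, whose
      partner in \<open>L2\<close> is \<open>u (1 - (s - i))\<close>; as \<open>\<psi> ^^ m\<close>
      sends \<open>u i\<close> to \<open>u (i + m)\<close>, this forces \<open>m\<close> to be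
      \<open>- c - j * g\<close> modulo \<open>k\<close>.\<close>
    define j where "j = nat ((d - c' - 1) mod int r)"
    define m where "m = nat ((- c - int j * int g) mod int k)"
    define \<theta> where "\<theta> = \<phi> ^^ j \<circ> \<rho>"
    have j: "(c' + 1 - i + int j) mod int r = (d - i) mod int r" for i
    proof -
      have "int j = (d - c' - 1) mod int r" using r by (simp add: j_def)
      then have "(c' + 1 - i + int j) mod int r = (c' + 1 - i + (d - c' - 1)) mod int r"
        by (simp add: mod_add_right_eq)
      then show ?thesis by (simp add: algebra_simps)
    qed
    have m: "(i + int m) mod int k = (i - c - int j * int g) mod int k" for i
    proof -
      have "int m = (- c - int j * int g) mod int k" using k by (simp add: m_def)
      then have "(i + int m) mod int k = (i + (- c - int j * int g)) mod int k"
        by (simp add: mod_add_right_eq)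
      then show ?thesis by (simp add: algebra_simps)
    qed
    have \<phi>_pow: "(\<phi> ^^ n) (w i) = w (i + int n * int g)" "(\<phi> ^^ n) (x i) = x (i + int n)" for n i
      by (induction n) (auto simp: \<phi>w \<phi>x algebra_simps)
    have \<psi>_pow: "(\<psi> ^^ n) (u i) = u (i + int n)" for n i
      by (induction n) (auto simp: \<psi> algebra_simps)
    have \<theta>w: "\<theta> (w i) = w (c + 1 - i + int j * int g)" for i
      by (simp add: \<theta>_def \<rho>w \<phi>_pow)
    have \<theta>x: "\<theta> (x i) = x (d - i)" for i
      using periodic_cong[of x, OF x_per j] by (simp add: \<theta>_def \<rho>x \<phi>_pow)
    have "automorphism W0 \<theta>" "automorphism R (\<psi> ^^ m)"
      unfolding \<theta>_def using assms(9,19,20)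
      by (simp_all only: automorphism_comp automorphism_funpow)
    then obtain h0 hR where
      \<theta>: "bij_betw \<theta> (verts W0) (verts W0)" and
      h0: "bij_betw h0 (edges W0) (edges W0)" "\<forall>e\<in>edges W0. ends W0 (h0 e) = \<theta> ` ends W0 e" and
      \<psi>m: "bij_betw (\<psi> ^^ m) (verts R) (verts R)" and
      hR: "bij_betw hR (edges R) (edges R)" "\<forall>e\<in>edges R. ends R (hR e) = (\<psi> ^^ m) ` ends R e"
      unfolding automorphism_def by blast
    define f where "f v = (if v \<in> verts R then (\<psi> ^^ m) v else \<theta> v)" for v
    let ?M = "verts R \<union> verts W0"
    have f_R: "f v = (\<psi> ^^ m) v" if "v \<in> verts R" for v using that by (simp add: f_def)
    have f_W: "f v = \<theta> v" if "v \<in> verts W0" for v using that assms(13) by (auto simp: f_def)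
    have "bij_betw f (verts R) (verts R)" "bij_betw f (verts W0) (verts W0)"
      using \<theta> \<psi>m f_R f_W bij_betw_cong by metis+
    then have f: "bij_betw f ?M ?M" using bij_betw_combine assms(13) by blast
    have "map_prod f f ` L1 = range (\<lambda>i. (f (u i), f (w i)))"
      by (auto simp: L1_def)
    also have "\<dots> = L2"
    proof -
      let ?s = "c + 1 + int j * int g"
      have "(f (u i), f (w i)) = (u (1 - (?s - i)), w (?s - i))" for i
      proof -
        have "f (u i) = u (i + int m)" using u_in by (simp add: f_R \<psi>_pow range_subsetD)
        also have "\<dots> = u (i - c - int j * int g)" by (rule periodic_cong[of u, OF u_per m])
        finally show ?thesis using w_in by (simp add: f_W \<theta>w range_subsetD algebra_simps)
      qed
      then have "range (\<lambda>i. (f (u i), f (w i))) = (\<lambda>i. (u (1 - i), w i)) ` range (\<lambda>i. ?s - i)"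
        by (simp only: image_image)
      \<comment> \<open>The image of \<open>L1\<close> is \<open>L2\<close> listed in the order
        \<open>?s - i\<close>, and this reindexing is onto the integers.\<close>
      moreover have "range (\<lambda>i. ?s - i) = UNIV" by (rule surjI[of _ "\<lambda>i. ?s - i"]) simp
      ultimately show ?thesis by (simp add: L2_def)
    qed
    finally have L: "map_prod f f ` L1 = L2" .
    then have L': "map_prod f f ` (L1\<inverse>) = L2\<inverse>" by force
    have "comps ?V (?S A B C L1) = comps ?V (?S (hR ` A) (h0 ` B) C L2)"
      if A: "A \<subseteq> edges R" and B: "B \<subseteq> edges W0" for A B
    proof -
      let ?P = "adjacency R A \<union> adjacency W0 B \<union> L1 \<union> L1\<inverse>"
      note subR = adjacency_subset[OF assms(5) A] and subW = adjacency_subset[OF assms(11) B]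
      have "map_prod f f ` adjacency R A = map_prod (\<psi> ^^ m) (\<psi> ^^ m) ` adjacency R A"
        using subR f_R by (intro image_cong) auto
      also have "\<dots> = adjacency R (hR ` A)"
        using adjacency_image[OF assms(5) A _ hR(2)] \<psi>m by (simp add: bij_betw_def)
      finally have imR: "map_prod f f ` adjacency R A = adjacency R (hR ` A)" .
      have "map_prod f f ` adjacency W0 B = map_prod \<theta> \<theta> ` adjacency W0 B"
        using subW f_W by (intro image_cong) auto
      also have "\<dots> = adjacency W0 (h0 ` B)"
        using adjacency_image[OF assms(11) B _ h0(2)] \<theta> by (simp add: bij_betw_def)
      finally have imW: "map_prod f f ` adjacency W0 B = adjacency W0 (h0 ` B)" .
      \<comment> \<open>Only \<open>R\<close>, \<open>W0\<close> and the links between them are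
        moved by \<open>f\<close>. The edges \<open>C\<close> of \<open>Y\<close> and the links
        \<open>X\<close> stay in place, which the choice of \<open>d\<close> makes harmless.\<close>
      have "comps (?M \<union> verts Y) (?P \<union> ?Q \<union> X \<union> X\<inverse>) =
          comps (?M \<union> verts Y) (map_prod f f ` ?P \<union> ?Q \<union> X \<union> X\<inverse>)"
        unfolding X_def
      proof (rule comps_reflect[OF _ f])
        show "?M \<inter> verts Y = {}" using assms(26,27) by blast
        show "?P \<subseteq> ?M \<times> ?M" using subR subW u_in w_in by (auto simp: L1_def)
        show "sym ?P"
          using sym_adjacency[of R A] sym_adjacency[of W0 B] by (auto simp: sym_def)
        show "?Q \<subseteq> verts Y \<times> verts Y" by (rule adjacency_subset[OF assms(25) C])
        show "f (x i) = x (d - i)" for i using x_in by (simp add: f_W \<theta>x range_subsetD)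
      qed (use sym_adjacency x_in z_in d in auto)
      then show ?thesis by (simp add: image_Un imR imW L L')
    qed
    then show ?thesis using hR(1) h0(1) by blast
  qed

  let ?us = "map u [1..int k]" and ?ws = "map w [1..int k]"
  have nc: "num_components (glue R us W ?ws) (A <+> (B <+> C)) =
      comps ?V (?S A B C (set (zip us ?ws)))"
    if "us \<in> {?us, rev ?us}" "A \<subseteq> edges R" "B \<subseteq> edges W0" "C \<subseteq> edges Y" for us A B C
    unfolding assms(30) zip3[symmetric]
  proof (rule num_components_glue_glue)
    show "distinct ?ws" "distinct (map y [1..int r])"
      using assms(14,28) by (auto simp: cyclic_family_def distinct_map)
  qed (use that assms(5,8,11,13,15,17,25-27,29) in auto)
  let ?E = "edges R <+> (edges W0 <+> edges Y)"
  \<comment> \<open>The edges of \<open>Y\<close> in a subset are the invariant along which the edge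
    bijection may vary.\<close>
  let ?p = "\<lambda>A. {e. Inr (Inr e) \<in> A}"
  have split: "A = Inl -` A <+> ((Inl -` (Inr -` A)) <+> ?p A)" for A :: "('e + 'f + 'h) set"
  proof (rule set_eqI)
    fix e show "e \<in> A \<longleftrightarrow> e \<in> Inl -` A <+> ((Inl -` (Inr -` A)) <+> ?p A)"
      by (cases e rule: sum.exhaust; cases "projr e") auto
  qed
  show ?thesis
  proof (rule T_equivalent_fibrewise)
    show "finite ?E" using assms(5,11,25) by (simp add: finite_mgraph_def)
    show "edges (glue R ?us W ?ws) = ?E" "edges (glue R (rev ?us) W ?ws) = ?E"
      using assms(30) by (auto simp: glue_def)
    show "verts (glue R ?us W ?ws) = verts (glue R (rev ?us) W ?ws)"
      using assms(8) by (simp add: verts_glue)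
    show "\<exists>h. bij_betw h ?E ?E \<and> (\<forall>A\<subseteq>?E. ?p A = C \<longrightarrow> ?p (h ` A) = C \<and>
        num_components (glue R ?us W ?ws) A = num_components (glue R (rev ?us) W ?ws) (h ` A))" for C
    proof (cases "C \<subseteq> edges Y")
      \<comment> \<open>The fibre over such a \<open>C\<close> is empty, so any bijection will
        do.\<close>
      case False
      then have "?p A \<noteq> C" if "A \<subseteq> ?E" for A using that by auto
      then show ?thesis by (intro exI[of _ id]) auto
    next
      case True
      then obtain hR h0 where hR: "bij_betw hR (edges R) (edges R)"
        and h0: "bij_betw h0 (edges W0) (edges W0)"
        and eq: "\<And>A B. A \<subseteq> edges R \<Longrightarrow> B \<subseteq> edges W0 \<Longrightarrow>
          comps ?V (?S A B C L1) = comps ?V (?S (hR ` A) (h0 ` B) C L2)"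
        using key[OF True] by (elim exE conjE) metis
      \<comment> \<open>Acting as the identity on the edges of \<open>Y\<close>, this map keeps the
        fibre over \<open>C\<close>.\<close>
      let ?h = "map_sum hR (map_sum h0 id)"
      have "bij_betw ?h ?E ?E"
        using hR h0 by (intro bij_betw_map_sum) auto
      moreover have "?p (?h ` A) = C"
        "num_components (glue R ?us W ?ws) A = num_components (glue R (rev ?us) W ?ws) (?h ` A)"
        if A: "A \<subseteq> ?E" "?p A = C" for A
      proof -
        define AR A0 where "AR = Inl -` A" and "A0 = Inl -` (Inr -` A)"
        have A_eq: "A = AR <+> (A0 <+> C)" using split[of A] A(2) by (simp add: AR_def A0_def)
        have sub: "AR \<subseteq> edges R" "A0 \<subseteq> edges W0" using A(1) by (auto simp: AR_def A0_def)
        have im: "?h ` A = hR ` AR <+> (h0 ` A0 <+> C)" by (simp add: A_eq map_sum_image_Plus)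
        then show "?p (?h ` A) = C" by auto
        have "hR ` AR \<subseteq> edges R" "h0 ` A0 \<subseteq> edges W0"
          using sub bij_betwE[OF hR] bij_betwE[OF h0] by auto
        then show "num_components (glue R ?us W ?ws) A =
            num_components (glue R (rev ?us) W ?ws) (?h ` A)"
          unfolding im unfolding A_eq using sub True
          by (simp only: nc insertI1 insertI2 eq zip1 zip2)
      qed
      ultimately show ?thesis by blast
    qed
  qed
qed

end
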